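(* Let $A\subseteq\mathbb N$, $d\in\mathbb N$, and let $a:\ell_A\to\mathbb R$ be a $d$-regular admissible positive function. The $d$-regular admissible space $\mathcal F_a'$ is a Våge space if and only if $a$ is superexponential, i.e. $$a_\alpha a_\beta\le a_{\alpha+\beta}\qquad\text{for all }\alpha,\beta\in\ell_A.$$ In this case its index is less than or equal to $d$.
   Context: $\mathbb N=\{1,2,\dots\}$, $\mathbb N_0=\mathbb N\cup\{0\}$. For $A\subseteq\mathbb N$, $\ell_A=\mathbb N_0^{(A)}$ is the additive monoid of finitely supported functions $A\to\mathbb N_0$; $e_n$ ($n\in A$) is the element equal to $1$ at $n$ and $0$ elsewhere. A positive function $a:\ell_A\to\mathbb R$ ($a_\alpha>0$ for all $\alpha$) is admissible if $a_0=1$ and $a_{e_n}>1$ for all $n\in A$; an admissible $a$ is $d$-regular ($d\in\mathbb N$) if $\sum_{n\in A}\frac{1}{a_{e_n}^d-1}<\infty$. For $p\in\mathbb N$ let $\ell^2_{a^{-p}}=\{f=(f_\alpha)_{\alpha\in\ell_A}\in\mathbb C^{\ell_A}:\|f\|_p<\infty\}$ with $\|f\|_p=\big(\sum_{\alpha}|f_\alpha|^2a_\alpha^{-p}\big)^{1/2}$. The dual of $\mathcal F_a=\{(\varphi_\alpha):\sum_\alpha|\varphi_\alpha|^2a_\alpha^p<\infty\ \forall p\in\mathbb N\}$ is written $\mathcal F_a'=\bigcup_{p\in\mathbb N}\ell^2_{a^{-p}}$; when $a$ is $d$-regular admissible it is called a $d$-regular admissible space (regular admissible if $d$-regular for some $d\in\mathbb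 N$). The convolution of $f,g\in\mathbb C^{\ell_A}$ is $fg=f*g=\big(\sum_{\alpha+\beta=\gamma}f_\alpha g_\beta\big)_{\gamma\in\ell_A}$. A regular admissible space $\mathcal F_a'$ is a Våge space if there is $e\in\mathbb N$ and finite positive numbers $A(k)$, $k\ge e$ (depending only on $k$), such that for all $q\in\mathbb N$ and all $p\ge q+e$, $\|fg\|_p\le A(p-q)\|f\|_q\|g\|_p$ for all $f\in\ell^2_{a^{-q}}$ and $g\in\ell^2_{a^{-p}}$. The minimal such $e$ is called the index of the space. *)

theory Defs
  imports "HOL-Analysis.Infinite_Sum" "HOL-Library.Poly_Mapping" "HOL-Library.Extended_Nonnegative_Real"
begin

definition ell :: "nat set \<Rightarrow> (nat \<Rightarrow>\<^sub>0 nat) set"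
  where "ell A = {\<alpha>. Poly_Mapping.keys \<alpha> \<subseteq> A}"

definition unit_index :: "nat \<Rightarrow> (nat \<Rightarrow>\<^sub>0 nat)"
  where "unit_index n = Poly_Mapping.single n 1"

text \<open>A function on \<open>ell A\<close> is represented by a total function on all multi-indices. The values
  of the weight \<open>a\<close> outside \<open>ell A\<close> are never used.\<close>

definition admissible :: "nat set \<Rightarrow> ((nat \<Rightarrow>\<^sub>0 nat) \<Rightarrow> real) \<Rightarrow> bool"
  where "admissible A a \<longleftrightarrow>
    (\<forall>\<alpha>\<in>ell A. a \<alpha> > 0) \<and> a 0 = 1 \<and> (\<forall>n\<in>A. a (unit_index n) > 1)"

definition regular_admissible :: "nat set \<Rightarrow> nat \<Rightarrow> ((nat \<Rightarrow>\<^sub>0 nat) \<Rightarrow> real) \<Rightarrow> bool"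
  where "regular_admissible A d a \<longleftrightarrow>
    1 \<le> d \<and> admissible A a \<and> (\<lambda>n. 1 / (a (unit_index n) ^ d - 1)) summable_on A"

definition superexponential :: "nat set \<Rightarrow> ((nat \<Rightarrow>\<^sub>0 nat) \<Rightarrow> real) \<Rightarrow> bool"
  where "superexponential A a \<longleftrightarrow> (\<forall>\<alpha>\<in>ell A. \<forall>\<beta>\<in>ell A. a \<alpha> * a \<beta> \<le> a (\<alpha> + \<beta>))"

text \<open>Complex families indexed by \<open>ell A\<close>, extended by zero.\<close>

definition families :: "nat set \<Rightarrow> ((nat \<Rightarrow>\<^sub>0 nat) \<Rightarrow> complex) set"
  where "families A = {f. \<forall>\<alpha>. \<alpha> \<notin> ell A \<longrightarrow> f \<alpha> = 0}"

text \<open>The norm takes values in \<open>[0, \<infinity>]\<close>; the divergent case is separated because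
  \<open>infsum\<close> is \<open>0\<close> on non-summable real families.\<close>

definition wnorm :: "nat set \<Rightarrow> ((nat \<Rightarrow>\<^sub>0 nat) \<Rightarrow> real) \<Rightarrow> nat
    \<Rightarrow> ((nat \<Rightarrow>\<^sub>0 nat) \<Rightarrow> complex) \<Rightarrow> ennreal"
  where "wnorm A a p f =
    (if (\<lambda>\<alpha>. (cmod (f \<alpha>))\<^sup>2 / a \<alpha> ^ p) summable_on ell A
     then ennreal (sqrt (\<Sum>\<^sub>\<infinity>\<alpha>\<in>ell A. (cmod (f \<alpha>))\<^sup>2 / a \<alpha> ^ p))
     else \<infinity>)"

definition weighted_l2 :: "nat set \<Rightarrow> ((nat \<Rightarrow>\<^sub>0 nat) \<Rightarrow> real) \<Rightarrow> nat
    \<Rightarrow> ((nat \<Rightarrow>\<^sub>0 nat) \<Rightarrow> complex) set"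
  where "weighted_l2 A a p = {f \<in> families A. wnorm A a p f < \<infinity>}"

definition convolution :: "nat set \<Rightarrow> ((nat \<Rightarrow>\<^sub>0 nat) \<Rightarrow> complex)
    \<Rightarrow> ((nat \<Rightarrow>\<^sub>0 nat) \<Rightarrow> complex) \<Rightarrow> ((nat \<Rightarrow>\<^sub>0 nat) \<Rightarrow> complex)"
  where "convolution A f g =
    (\<lambda>\<gamma>. \<Sum>(\<alpha>, \<beta>) \<in> {(\<alpha>, \<beta>). \<alpha> \<in> ell A \<and> \<beta> \<in> ell A \<and> \<alpha> + \<beta> = \<gamma>}. f \<alpha> * g \<beta>)"

text \<open>The index set of the sum in \<open>convolution\<close> is finite, so \<open>sum\<close> is not degenerate there.\<close>

lemma finite_convolution_index:
  "finite {(\<alpha>, \<beta>). \<alpha> \<in> ell A \<and> \<beta> \<in> ell A \<and> \<alpha> + \<beta> = (\<gamma> :: nat \<Rightarrow>\<^sub>0 nat)}"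
    (is "finite ?S")
proof -
  let ?L = "Poly_Mapping.lookup :: (nat \<Rightarrow>\<^sub>0 nat) \<Rightarrow> nat \<Rightarrow> nat"
  let ?K = "Poly_Mapping.keys \<gamma>"
  let ?F = "{h. \<forall>n. (n \<in> ?K \<longrightarrow> h n \<in> {..Max (?L \<gamma> ` ?K)}) \<and> (n \<notin> ?K \<longrightarrow> h n = 0)}"
  have fin: "finite ?F"
    by (rule finite_set_of_finite_funs) auto
  have le: "?L \<alpha> n \<le> ?L \<gamma> n" "?L \<beta> n \<le> ?L \<gamma> n" if "\<alpha> + \<beta> = \<gamma>" for \<alpha> \<beta> n
    using that by (auto simp: lookup_add)
  have mem: "?L \<alpha> \<in> ?F" if "\<And>n. ?L \<alpha> n \<le> ?L \<gamma> n" for \<alpha>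
  proof -
    have "?L \<alpha> n \<le> Max (?L \<gamma> ` ?K)" if "n \<in> ?K" for n
      using that \<open>\<And>n. ?L \<alpha> n \<le> ?L \<gamma> n\<close>[of n] by (meson Max_ge finite_imageI finite_keys imageI le_trans)
    moreover have "?L \<alpha> n = 0" if "n \<notin> ?K" for n
      using that \<open>\<And>n. ?L \<alpha> n \<le> ?L \<gamma> n\<close>[of n] by (simp add: in_keys_iff)
    ultimately show ?thesis by auto
  qed
  have "inj ?L" by (simp add: inj_on_def poly_mapping_eqI)
  then have "finite (?L -` ?F)" using fin by (rule finite_vimageI[rotated])
  moreover have "?S \<subseteq> (?L -` ?F) \<times> (?L -` ?F)"
    using le mem by blast
  ultimately show ?thesis by (meson finite_SigmaI finite_subset)
qed

text \<open>The space is presented by its index set and weight \<open>(A, a)\<close>, which determine the norms.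
  The parameter \<open>e\<close> is a gap for which the Vage inequalities hold.\<close>

definition vage_gap :: "nat set \<Rightarrow> ((nat \<Rightarrow>\<^sub>0 nat) \<Rightarrow> real) \<Rightarrow> nat \<Rightarrow> bool"
  where "vage_gap A a e \<longleftrightarrow> 1 \<le> e \<and>
    (\<exists>C :: nat \<Rightarrow> real. (\<forall>k\<ge>e. C k > 0) \<and>
      (\<forall>q\<ge>1. \<forall>p\<ge>q + e. \<forall>f\<in>weighted_l2 A a q. \<forall>g\<in>weighted_l2 A a p.
        wnorm A a p (convolution A f g) \<le> ennreal (C (p - q)) * wnorm A a q f * wnorm A a p g))"

definition vage_space :: "nat set \<Rightarrow> ((nat \<Rightarrow>\<^sub>0 nat) \<Rightarrow> real) \<Rightarrow> bool"
  where "vage_space A a \<longleftrightarrow> (\<exists>d. regular_admissible A d a) \<and> (\<exists>e. vage_gap A a e)"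

definition vage_index :: "nat set \<Rightarrow> ((nat \<Rightarrow>\<^sub>0 nat) \<Rightarrow> real) \<Rightarrow> nat"
  where "vage_index A a = (LEAST e. vage_gap A a e)"

end

theory Submission
  imports Defs "HOL-Analysis.Convex"
begin

text \<open>If \<open>a\<close> is superexponential, then \<open>a \<alpha> \<ge> (\<Prod>n. a\<^bsub>e n\<^esub> ^ \<alpha> n)\<close>, so \<open>\<Sum>\<alpha>. 1 / a \<alpha> ^ d\<close> is bounded by
  the product of the geometric series \<open>\<Prod>n. (1 + 1 / (a\<^bsub>e n\<^esub> ^ d - 1))\<close>, which converges by
  \<open>d\<close>-regularity. Young's inequality \<open>\<parallel>F * G\<parallel>\<^sub>2 \<le> \<parallel>F\<parallel>\<^sub>1 \<parallel>G\<parallel>\<^sub>2\<close> for \<open>F = \<bar>f\<bar> a\<^sup>-\<^sup>p\<^sup>/\<^sup>2\<close>,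
  \<open>G = \<bar>g\<bar> a\<^sup>-\<^sup>p\<^sup>/\<^sup>2\<close>, together with Cauchy--Schwarz for \<open>\<parallel>F\<parallel>\<^sub>1\<close>, gives the Vage inequality with a constant
  independent of \<open>p - q\<close>. Conversely, the Vage inequality for point masses at \<open>\<alpha>\<close> and \<open>\<beta>\<close> with
  \<open>p - q\<close> fixed bounds all powers of \<open>a \<alpha> * a \<beta> / a (\<alpha> + \<beta>)\<close>, which is therefore at most \<open>1\<close>.\<close>

section \<open>Multi-indices supported in \<open>A\<close>\<close>

lemma ell_zero [simp]: "0 \<in> ell A"
  by (simp add: ell_def)

lemma ell_add: "\<alpha> \<in> ell A \<Longrightarrow> \<beta> \<in> ell A \<Longrightarrow> \<alpha> + \<beta> \<in> ell A"
  using keys_add[of \<alpha> \<beta>] by (auto simp: ell_def)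

lemma ell_single: "n \<in> A \<Longrightarrow> Poly_Mapping.single n m \<in> ell A"
  by (auto simp: ell_def)

lemma ell_sum: "(\<And>i. i \<in> I \<Longrightarrow> f i \<in> ell A) \<Longrightarrow> sum f I \<in> ell A"
  by (induction I rule: infinite_finite_induct) (auto intro: ell_add)

lemma poly_mapping_sum_single:
  assumes "finite K" "Poly_Mapping.keys \<alpha> \<subseteq> K"
  shows "(\<Sum>n\<in>K. Poly_Mapping.single n (Poly_Mapping.lookup \<alpha> n)) = \<alpha>"
proof (rule poly_mapping_eqI)
  fix k
  show "Poly_Mapping.lookup (\<Sum>n\<in>K. Poly_Mapping.single n (Poly_Mapping.lookup \<alpha> n)) k
      = Poly_Mapping.lookup \<alpha> k"
    using assms by (auto simp: lookup_sum lookup_single when_def in_keys_iff)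
qed

section \<open>Lower bounds for superexponential weights\<close>

lemma admissible_pos: "admissible A a \<Longrightarrow> \<alpha> \<in> ell A \<Longrightarrow> a \<alpha> > 0"
  by (simp add: admissible_def)

lemma superexponential_power_le_single:
  assumes "admissible A a" "superexponential A a" "n \<in> A"
  shows "a (unit_index n) ^ m \<le> a (Poly_Mapping.single n m)"
proof (induction m)
  case 0
  then show ?case using assms(1) by (simp add: admissible_def)
next
  case (Suc m)
  have pos: "0 \<le> a (unit_index n)"
    using assms by (auto simp: admissible_def intro: less_imp_le order.strict_trans[OF zero_less_one])
  have "a (unit_index n) ^ Suc m \<le> a (unit_index n) * a (Poly_Mapping.single n m)"
    using mult_left_mono[OF Suc pos] by simp
  also have "\<dots> \<le> a (unit_index n + Poly_Mapping.single n m)"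
    using assms(2,3) unfolding superexponential_def unit_index_def by (auto intro: ell_single)
  also have "unit_index n + Poly_Mapping.single n m = Poly_Mapping.single n (Suc m)"
    by (simp add: unit_index_def single_add[symmetric])
  finally show ?case .
qed

text \<open>Each induction step splits off one coordinate by superexponentiality. The exponents
  \<open>m\<close> are arbitrary, and not the entries of a multi-index supported in
  \<open>K\<close>, so that they stay fixed while \<open>K\<close> grows.\<close>

lemma superexponential_prod_le_sum:
  assumes "admissible A a" "superexponential A a" "finite K" "K \<subseteq> A"
  shows "(\<Prod>n\<in>K. a (unit_index n) ^ m n) \<le> a (\<Sum>n\<in>K. Poly_Mapping.single n (m n))"
  using assms(3,4)
proof (induction K)
  case empty
  then show ?case using assms(1) by (simp add: admissible_def)
next
  case (insert k K)
  have one: "1 < a (unit_index n)" if "n \<in> A" for n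
    using assms(1) that by (simp add: admissible_def)
  have sum: "(\<Sum>n\<in>K. Poly_Mapping.single n (m n)) \<in> ell A"
    using insert.prems by (intro ell_sum ell_single) auto
  have single: "Poly_Mapping.single k (m k) \<in> ell A"
    using insert.prems by (intro ell_single) auto
  have "(\<Prod>n\<in>insert k K. a (unit_index n) ^ m n)
      = a (unit_index k) ^ m k * (\<Prod>n\<in>K. a (unit_index n) ^ m n)"
    using insert.hyps by simp
  also have "\<dots> \<le> a (Poly_Mapping.single k (m k)) * a (\<Sum>n\<in>K. Poly_Mapping.single n (m n))"
  proof (rule mult_mono)
    show "a (unit_index k) ^ m k \<le> a (Poly_Mapping.single k (m k))"
      using insert.prems by (intro superexponential_power_le_single[OF assms(1,2)]) auto
    show "(\<Prod>n\<in>K. a (unit_index n) ^ m n) \<le> a (\<Sum>n\<in>K. Poly_Mapping.single n (m n))"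
      using insert by auto
    show "0 \<le> a (Poly_Mapping.single k (m k))"
      using admissible_pos[OF assms(1) single] by simp
    show "0 \<le> (\<Prod>n\<in>K. a (unit_index n) ^ m n)"
      using insert.prems by (force intro!: prod_nonneg zero_le_power dest: one)
  qed
  also have "\<dots> \<le> a (Poly_Mapping.single k (m k) + (\<Sum>n\<in>K. Poly_Mapping.single n (m n)))"
    using assms(2) single sum by (simp add: superexponential_def)
  finally show ?case using insert.hyps by simp
qed

text \<open>\<open>K\<close> may be larger than the support of \<alpha>, so that one product range
  can serve a whole finite family of multi-indices.\<close>

lemma superexponential_prod_le:
  assumes "admissible A a" "superexponential A a" "finite K" "K \<subseteq> A" "Poly_Mapping.keys \<alpha> \<subseteq> K"
  shows "(\<Prod>n\<in>K. a (unit_index n) ^ Poly_Mapping.lookup \<alpha> n) \<le> a \<alpha>"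
  using superexponential_prod_le_sum[OF assms(1-4), of "Poly_Mapping.lookup \<alpha>"]
  by (simp add: poly_mapping_sum_single assms)

text \<open>This makes \<open>a \<alpha> ^ k\<close> increasing in \<open>k\<close>, so that
  summability with exponent \<open>d\<close> carries over to every exponent
  \<open>p - q \<ge> d\<close>.\<close>

lemma superexponential_ge_one:
  assumes "admissible A a" "superexponential A a" "\<alpha> \<in> ell A"
  shows "1 \<le> a \<alpha>"
proof -
  have K: "Poly_Mapping.keys \<alpha> \<subseteq> A"
    using assms(3) by (simp add: ell_def)
  have "1 \<le> (\<Prod>n\<in>Poly_Mapping.keys \<alpha>. a (unit_index n) ^ Poly_Mapping.lookup \<alpha> n)"
    using assms(1) K by (intro prod_ge_1 one_le_power) (auto simp: admissible_def less_imp_le)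
  also have "\<dots> \<le> a \<alpha>"
    by (rule superexponential_prod_le[OF assms(1,2)]) (use K in auto)
  finally show ?thesis .
qed

section \<open>Summability of the inverse weight\<close>

text \<open>The full geometric series equals \<open>1 + 1 / (t - 1)\<close>. Passing to the
  exponential turns the later product over coordinates into the sum that regularity
  controls.\<close>

lemma sum_power_le_exp:
  fixes t :: real
  assumes "1 < t"
  shows "(\<Sum>j\<le>N. (1 / t) ^ j) \<le> exp (1 / (t - 1))"
proof -
  have "(\<Sum>j\<le>N. (1 / t) ^ j) = (1 - (1 / t) ^ Suc N) / (1 - 1 / t)"
    using assms by (simp only: sum_gp0) (simp)
  also have "\<dots> \<le> 1 / (1 - 1 / t)"
    using assms by (intro divide_right_mono) auto
  also have "\<dots> = 1 + 1 / (t - 1)"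
    using assms by (simp add: field_simps)
  also have "\<dots> \<le> exp (1 / (t - 1))"
    by (rule exp_ge_add_one_self)
  finally show ?thesis .
qed

text \<open>Expanding the right-hand side gives one monomial for each function from \<open>K\<close>
  to \<open>{..N}\<close>. The members of \<open>X\<close> yield distinct monomials among these, and
  the remaining ones are nonnegative.\<close>

lemma sum_prod_power_le:
  fixes x :: "nat \<Rightarrow> real"
  assumes K: "finite K" and x: "\<And>n. n \<in> K \<Longrightarrow> 0 \<le> x n"
    and X: "finite X" "\<And>\<alpha>. \<alpha> \<in> X \<Longrightarrow> Poly_Mapping.keys \<alpha> \<subseteq> K"
      "\<And>\<alpha> n. \<alpha> \<in> X \<Longrightarrow> Poly_Mapping.lookup \<alpha> n \<le> N"
  shows "(\<Sum>\<alpha>\<in>X. \<Prod>n\<in>K. x n ^ Poly_Mapping.lookup \<alpha> n) \<le> (\<Prod>n\<in>K. \<Sum>j\<le>N. x n ^ j)"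
proof -
  \<comment> \<open>\<open>PiE\<close> contains only functions that are undefined outside
    \<open>K\<close>. The restriction loses nothing, since all supports lie in
    \<open>K\<close>.\<close>
  define r where "r \<alpha> = restrict (Poly_Mapping.lookup \<alpha>) K" for \<alpha> :: "nat \<Rightarrow>\<^sub>0 nat"
  have inj: "inj_on r X"
  proof (rule inj_onI, rule poly_mapping_eqI)
    fix \<alpha> \<beta> n assume *: "\<alpha> \<in> X" "\<beta> \<in> X" "r \<alpha> = r \<beta>"
    show "Poly_Mapping.lookup \<alpha> n = Poly_Mapping.lookup \<beta> n"
    proof (cases "n \<in> K")
      case True
      then show ?thesis using fun_cong[OF *(3), of n] by (simp add: r_def)
    next
      case False
      then have "n \<notin> Poly_Mapping.keys \<alpha>" "n \<notin> Poly_Mapping.keys \<beta>"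
        using X(2) * by auto
      then show ?thesis by (simp add: in_keys_iff)
    qed
  qed
  have "(\<Sum>\<alpha>\<in>X. \<Prod>n\<in>K. x n ^ Poly_Mapping.lookup \<alpha> n) = (\<Sum>\<alpha>\<in>X. \<Prod>n\<in>K. x n ^ r \<alpha> n)"
    by (intro sum.cong prod.cong) (auto simp: r_def)
  also have "\<dots> = (\<Sum>h\<in>r ` X. \<Prod>n\<in>K. x n ^ h n)"
    using inj by (simp add: sum.reindex)
  also have "\<dots> \<le> (\<Sum>h\<in>PiE K (\<lambda>_. {..N}). \<Prod>n\<in>K. x n ^ h n)"
  proof (rule sum_mono2)
    show "finite (PiE K (\<lambda>_. {..N}))"
      using K by (intro finite_PiE) auto
    show "r ` X \<subseteq> PiE K (\<lambda>_. {..N})"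
      using X(3) by (auto simp: r_def)
    show "0 \<le> (\<Prod>n\<in>K. x n ^ h n)" for h
      using x by (auto intro: prod_nonneg)
  qed
  also have "\<dots> = (\<Prod>n\<in>K. \<Sum>j\<le>N. x n ^ j)"
    using K by (subst prod_sum_PiE) auto
  finally show ?thesis .
qed

text \<open>The finite set \<open>X\<close> fits into a box of multi-indices, over which the sum of
  the products of powers factors into geometric sums. The bound is the same for all
  \<open>X\<close>.\<close>

lemma sum_inverse_weight_le:
  assumes reg: "regular_admissible A d a" and sup: "superexponential A a"
    and X: "finite X" "X \<subseteq> ell A"
  shows "(\<Sum>\<alpha>\<in>X. 1 / a \<alpha> ^ d) \<le> exp (\<Sum>\<^sub>\<infinity>n\<in>A. 1 / (a (unit_index n) ^ d - 1))"
proof -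
  have adm: "admissible A a" and d: "1 \<le> d"
    and summ: "(\<lambda>n. 1 / (a (unit_index n) ^ d - 1)) summable_on A"
    using reg by (auto simp: regular_admissible_def)
  define t where "t n = a (unit_index n) ^ d" for n
  have t: "1 < t n" if "n \<in> A" for n
    using adm that d by (auto simp: admissible_def t_def intro: one_less_power)
  define K where "K = (\<Union>\<alpha>\<in>X. Poly_Mapping.keys \<alpha>)"
  \<comment> \<open>Inserting 0 keeps the maximum meaningful if \<open>X\<close> is empty or
    contains only the zero multi-index.\<close>
  define N where "N = Max (insert 0 (\<Union>\<alpha>\<in>X. Poly_Mapping.lookup \<alpha> ` Poly_Mapping.keys \<alpha>))"
  have K: "finite K" "K \<subseteq> A"
    using X by (auto simp: K_def ell_def)
  have N: "Poly_Mapping.lookup \<alpha> n \<le> N" if "\<alpha> \<in> X" for \<alpha> n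
  proof (cases "n \<in> Poly_Mapping.keys \<alpha>")
    case True
    then show ?thesis unfolding N_def using X(1) that by (intro Max_ge) auto
  next
    case False
    then show ?thesis by (simp add: in_keys_iff)
  qed
  have "(\<Sum>\<alpha>\<in>X. 1 / a \<alpha> ^ d) \<le> (\<Sum>\<alpha>\<in>X. \<Prod>n\<in>K. (1 / t n) ^ Poly_Mapping.lookup \<alpha> n)"
  proof (rule sum_mono)
    fix \<alpha> assume \<alpha>: "\<alpha> \<in> X"
    define P where "P = (\<Prod>n\<in>K. a (unit_index n) ^ Poly_Mapping.lookup \<alpha> n)"
    have P: "0 < P"
      unfolding P_def using adm K(2)
      by (intro prod_pos zero_less_power ballI) (force simp: admissible_def)
    have "P \<le> a \<alpha>"
      unfolding P_def using \<alpha> K by (intro superexponential_prod_le[OF adm sup]) (auto simp: K_def)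
    then have "1 / a \<alpha> ^ d \<le> 1 / P ^ d"
      using P by (intro divide_left_mono power_mono mult_pos_pos zero_less_power) auto
    also have "\<dots> = (\<Prod>n\<in>K. (1 / t n) ^ Poly_Mapping.lookup \<alpha> n)"
      by (simp add: P_def t_def prod_power_distrib prod_dividef power_one_over
        power_mult[symmetric] mult.commute)
    finally show "1 / a \<alpha> ^ d \<le> (\<Prod>n\<in>K. (1 / t n) ^ Poly_Mapping.lookup \<alpha> n)" .
  qed
  also have "\<dots> \<le> (\<Prod>n\<in>K. \<Sum>j\<le>N. (1 / t n) ^ j)"
  proof (rule sum_prod_power_le[OF K(1) _ X(1)])
    show "0 \<le> 1 / t n" if "n \<in> K" for n
      using t[of n] that K(2) by auto
  qed (use N in \<open>auto simp: K_def\<close>)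
  also have "\<dots> \<le> (\<Prod>n\<in>K. exp (1 / (t n - 1)))"
  proof (rule prod_mono)
    fix n assume "n \<in> K"
    then have "1 < t n" using t K(2) by auto
    then show "0 \<le> (\<Sum>j\<le>N. (1 / t n) ^ j) \<and> (\<Sum>j\<le>N. (1 / t n) ^ j) \<le> exp (1 / (t n - 1))"
      by (intro conjI sum_nonneg sum_power_le_exp) auto
  qed
  also have "\<dots> = exp (\<Sum>n\<in>K. 1 / (t n - 1))"
    using K(1) by (simp add: exp_sum)
  \<comment> \<open>The dependence on \<open>X\<close> through \<open>K\<close> disappears here, as
    the terms are nonnegative and summable over \<open>A\<close>.\<close>
  also have "\<dots> \<le> exp (\<Sum>\<^sub>\<infinity>n\<in>A. 1 / (t n - 1))"
    using summ K t by (intro exp_le_cancel_iff[THEN iffD2] finite_sum_le_infsum)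
      (auto simp: t_def less_imp_le)
  finally show ?thesis by (simp add: t_def)
qed

section \<open>Weighted norms through finite partial sums\<close>

text \<open>Bounded partial sums of nonnegative terms force summability, which rules out the
  infinite branch of \<open>wnorm\<close>. With the converse below, all estimates reduce to finite
  sums.\<close>

lemma wnorm_le:
  assumes "admissible A a" "0 \<le> K"
    and fin: "\<And>X. finite X \<Longrightarrow> X \<subseteq> ell A \<Longrightarrow> (\<Sum>\<alpha>\<in>X. (cmod (f \<alpha>))\<^sup>2 / a \<alpha> ^ p) \<le> K\<^sup>2"
  shows "wnorm A a p f \<le> ennreal K"
proof -
  have summ: "(\<lambda>\<alpha>. (cmod (f \<alpha>))\<^sup>2 / a \<alpha> ^ p) summable_on ell A"
  proof (rule nonneg_bdd_above_summable_on)
    show "0 \<le> (cmod (f \<alpha>))\<^sup>2 / a \<alpha> ^ p" if "\<alpha> \<in> ell A" for \<alpha>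
      using admissible_pos[OF assms(1) that] by auto
    show "bdd_above (sum (\<lambda>\<alpha>. (cmod (f \<alpha>))\<^sup>2 / a \<alpha> ^ p) ` {F. F \<subseteq> ell A \<and> finite F})"
      using fin by (auto intro!: bdd_aboveI)
  qed
  then have "sqrt (\<Sum>\<^sub>\<infinity>\<alpha>\<in>ell A. (cmod (f \<alpha>))\<^sup>2 / a \<alpha> ^ p) \<le> K"
    using fin assms(2) by (intro real_le_lsqrt infsum_le_finite_sums) auto
  with summ show ?thesis by (simp add: wnorm_def ennreal_leI)
qed

lemma weighted_l2_obtain:
  assumes "admissible A a" "f \<in> weighted_l2 A a p"
  obtains K where "0 \<le> K" "wnorm A a p f = ennreal K"
    "\<And>X. finite X \<Longrightarrow> X \<subseteq> ell A \<Longrightarrow> (\<Sum>\<alpha>\<in>X. (cmod (f \<alpha>))\<^sup>2 / a \<alpha> ^ p) \<le> K\<^sup>2"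
proof -
  let ?s = "\<Sum>\<^sub>\<infinity>\<alpha>\<in>ell A. (cmod (f \<alpha>))\<^sup>2 / a \<alpha> ^ p"
  have summ: "(\<lambda>\<alpha>. (cmod (f \<alpha>))\<^sup>2 / a \<alpha> ^ p) summable_on ell A"
    using assms(2) by (auto simp: weighted_l2_def wnorm_def split: if_splits)
  have nonneg: "0 \<le> (cmod (f \<alpha>))\<^sup>2 / a \<alpha> ^ p" if "\<alpha> \<in> ell A" for \<alpha>
    using admissible_pos[OF assms(1) that] by auto
  have s: "0 \<le> ?s"
    using nonneg by (rule infsum_nonneg)
  show thesis
  proof (rule that[of "sqrt ?s"])
    show "wnorm A a p f = ennreal (sqrt ?s)"
      using summ by (simp add: wnorm_def)
    show "(\<Sum>\<alpha>\<in>X. (cmod (f \<alpha>))\<^sup>2 / a \<alpha> ^ p) \<le> (sqrt ?s)\<^sup>2" if "finite X" "X \<subseteq> ell A" for X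
      using finite_sum_le_infsum[OF summ that] nonneg s by auto
  qed (use s in auto)
qed

section \<open>Young's inequality for convolutions\<close>

text \<open>Cauchy--Schwarz with weight \<open>F\<close> on each fibre of the addition costs one
  factor \<open>M1\<close>. Summing the remaining \<open>F \<alpha> * (G \<beta>)\<^sup>2\<close>
  over all fibres costs at most \<open>M1 * M2\<close>.\<close>

lemma sum_convolution_square_le:
  fixes F G :: "'a::cancel_ab_semigroup_add \<Rightarrow> real"
  assumes fin: "finite \<Gamma>" "\<And>\<gamma>. \<gamma> \<in> \<Gamma> \<Longrightarrow> finite {(\<alpha>, \<beta>). \<alpha> \<in> L \<and> \<beta> \<in> L \<and> \<alpha> + \<beta> = \<gamma>}"
    and nonneg: "\<And>\<alpha>. \<alpha> \<in> L \<Longrightarrow> 0 \<le> F \<alpha>"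
    and M1: "\<And>X. finite X \<Longrightarrow> X \<subseteq> L \<Longrightarrow> sum F X \<le> M1"
    and M2: "\<And>X. finite X \<Longrightarrow> X \<subseteq> L \<Longrightarrow> (\<Sum>\<beta>\<in>X. (G \<beta>)\<^sup>2) \<le> M2"
  shows "(\<Sum>\<gamma>\<in>\<Gamma>. (\<Sum>(\<alpha>, \<beta>)\<in>{(\<alpha>, \<beta>). \<alpha> \<in> L \<and> \<beta> \<in> L \<and> \<alpha> + \<beta> = \<gamma>}. F \<alpha> * G \<beta>)\<^sup>2) \<le> M1\<^sup>2 * M2"
proof -
  define S where "S \<gamma> = {(\<alpha>, \<beta>). \<alpha> \<in> L \<and> \<beta> \<in> L \<and> \<alpha> + \<beta> = \<gamma>}" for \<gamma>
  have finS: "finite (S \<gamma>)" if "\<gamma> \<in> \<Gamma>" for \<gamma>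
    using fin(2)[OF that] by (simp add: S_def)
  have SL: "fst z \<in> L \<and> snd z \<in> L" if "z \<in> S \<gamma>" for z \<gamma>
    using that by (auto simp: S_def)
  have M1_nonneg: "0 \<le> M1"
    using M1[of "{}"] by simp
  have CS: "(\<Sum>z\<in>S \<gamma>. F (fst z) * G (snd z))\<^sup>2 \<le> M1 * (\<Sum>z\<in>S \<gamma>. F (fst z) * (G (snd z))\<^sup>2)"
    if "\<gamma> \<in> \<Gamma>" for \<gamma>
  proof -
    \<comment> \<open>Writing \<open>F\<close> as a product of two square roots leaves
      \<open>F\<close> alone in one Cauchy--Schwarz factor and \<open>F\<close> times the square of
      \<open>G\<close> in the other.\<close>
    have "(\<Sum>z\<in>S \<gamma>. F (fst z) * G (snd z))
        = (\<Sum>z\<in>S \<gamma>. sqrt (F (fst z)) * (sqrt (F (fst z)) * G (snd z)))"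
      using SL nonneg by (intro sum.cong) (auto simp flip: mult.assoc)
    then have "(\<Sum>z\<in>S \<gamma>. F (fst z) * G (snd z))\<^sup>2
        \<le> (\<Sum>z\<in>S \<gamma>. (sqrt (F (fst z)))\<^sup>2) * (\<Sum>z\<in>S \<gamma>. (sqrt (F (fst z)) * G (snd z))\<^sup>2)"
      by (simp only: Cauchy_Schwarz_ineq_sum)
    also have "(\<Sum>z\<in>S \<gamma>. (sqrt (F (fst z)) * G (snd z))\<^sup>2) = (\<Sum>z\<in>S \<gamma>. F (fst z) * (G (snd z))\<^sup>2)"
      using SL nonneg by (intro sum.cong) (auto simp: power_mult_distrib)
    also have "(\<Sum>z\<in>S \<gamma>. (sqrt (F (fst z)))\<^sup>2) = (\<Sum>z\<in>S \<gamma>. F (fst z))"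
      using SL nonneg by (intro sum.cong) auto
    also have "\<dots> = sum F (fst ` S \<gamma>)"
    proof -
      \<comment> \<open>By cancellation, \<alpha> and \<gamma> determine \<beta>.\<close>
      have "inj_on fst (S \<gamma>)"
        by (auto simp: inj_on_def S_def)
      then show ?thesis by (simp add: sum.reindex)
    qed
    also have "sum F (fst ` S \<gamma>) * (\<Sum>z\<in>S \<gamma>. F (fst z) * (G (snd z))\<^sup>2)
        \<le> M1 * (\<Sum>z\<in>S \<gamma>. F (fst z) * (G (snd z))\<^sup>2)"
      using finS[OF that] SL nonneg
      by (intro mult_right_mono M1 sum_nonneg mult_nonneg_nonneg) auto
    finally show ?thesis .
  qed
  \<comment> \<open>The fibres are disjoint, so the double sum is a sum over their union. Enlarging
    \<open>U\<close> to the rectangle of its projections lets that sum factor.\<close>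
  define U where "U = (\<Union>\<gamma>\<in>\<Gamma>. S \<gamma>)"
  have finU: "finite U"
    using fin(1) finS by (simp add: U_def)
  have UL: "fst ` U \<subseteq> L" "snd ` U \<subseteq> L"
    using SL by (auto simp: U_def)
  have "(\<Sum>\<gamma>\<in>\<Gamma>. \<Sum>z\<in>S \<gamma>. F (fst z) * (G (snd z))\<^sup>2) = (\<Sum>z\<in>U. F (fst z) * (G (snd z))\<^sup>2)"
    unfolding U_def using fin(1) finS by (subst sum.UNION_disjoint) (auto simp: S_def)
  also have "\<dots> \<le> (\<Sum>z\<in>fst ` U \<times> snd ` U. F (fst z) * (G (snd z))\<^sup>2)"
  proof (rule sum_mono2)
    show "U \<subseteq> fst ` U \<times> snd ` U" by force
    show "0 \<le> F (fst z) * (G (snd z))\<^sup>2" if "z \<in> fst ` U \<times> snd ` U - U" for z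
      using that UL nonneg by (intro mult_nonneg_nonneg) auto
  qed (use finU in auto)
  also have "\<dots> = sum F (fst ` U) * (\<Sum>\<beta>\<in>snd ` U. (G \<beta>)\<^sup>2)"
    by (simp add: sum_product sum.cartesian_product case_prod_beta)
  also have "\<dots> \<le> M1 * M2"
    using finU UL M1_nonneg by (intro mult_mono M1 M2 sum_nonneg) auto
  finally have total: "(\<Sum>\<gamma>\<in>\<Gamma>. \<Sum>z\<in>S \<gamma>. F (fst z) * (G (snd z))\<^sup>2) \<le> M1 * M2" .
  have "(\<Sum>\<gamma>\<in>\<Gamma>. (\<Sum>z\<in>S \<gamma>. F (fst z) * G (snd z))\<^sup>2)
      \<le> (\<Sum>\<gamma>\<in>\<Gamma>. M1 * (\<Sum>z\<in>S \<gamma>. F (fst z) * (G (snd z))\<^sup>2))"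
    by (intro sum_mono CS)
  also have "\<dots> = M1 * (\<Sum>\<gamma>\<in>\<Gamma>. \<Sum>z\<in>S \<gamma>. F (fst z) * (G (snd z))\<^sup>2)"
    by (simp add: sum_distrib_left)
  also have "\<dots> \<le> M1 * (M1 * M2)"
    using total M1_nonneg by (rule mult_left_mono)
  finally show ?thesis
    by (simp add: S_def case_prod_beta power2_eq_square mult.assoc)
qed

section \<open>Superexponential weights satisfy the Vage inequality\<close>

text \<open>The gap \<open>d\<close> enters through the bound on \<open>sum F X\<close>, where
  \<open>p - q \<ge> d\<close> makes the inverse weights summable.\<close>

lemma superexponential_imp_vage_gap:
  assumes reg: "regular_admissible A d a" and sup: "superexponential A a"
  shows "vage_gap A a d"
proof -
  have adm: "admissible A a" and d: "1 \<le> d"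
    using reg by (auto simp: regular_admissible_def)
  define S where "S = exp (\<Sum>\<^sub>\<infinity>n\<in>A. 1 / (a (unit_index n) ^ d - 1))"
  have S: "0 < S" by (simp add: S_def)
  have "wnorm A a p (convolution A f g) \<le> ennreal (sqrt S) * wnorm A a q f * wnorm A a p g"
    if pq: "q + d \<le> p" and f: "f \<in> weighted_l2 A a q" and g: "g \<in> weighted_l2 A a p" for p q f g
  proof -
    obtain Kf where Kf: "0 \<le> Kf" "wnorm A a q f = ennreal Kf"
      "\<And>X. finite X \<Longrightarrow> X \<subseteq> ell A \<Longrightarrow> (\<Sum>\<alpha>\<in>X. (cmod (f \<alpha>))\<^sup>2 / a \<alpha> ^ q) \<le> Kf\<^sup>2"
      using weighted_l2_obtain[OF adm f] by blast
    obtain Kg where Kg: "0 \<le> Kg" "wnorm A a p g = ennreal Kg"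
      "\<And>X. finite X \<Longrightarrow> X \<subseteq> ell A \<Longrightarrow> (\<Sum>\<alpha>\<in>X. (cmod (g \<alpha>))\<^sup>2 / a \<alpha> ^ p) \<le> Kg\<^sup>2"
      using weighted_l2_obtain[OF adm g] by blast
    have pos: "0 < a \<alpha>" if "\<alpha> \<in> ell A" for \<alpha>
      using admissible_pos[OF adm that] .
    have sqrt_sq: "(sqrt (a \<alpha>) ^ m)\<^sup>2 = a \<alpha> ^ m" if "\<alpha> \<in> ell A" for \<alpha> m
      using pos[OF that] by (simp add: power_mult[symmetric] mult.commute[of m]) (simp add: power_mult)
    \<comment> \<open>Powers of \<open>sqrt (a \<alpha>)\<close> stand for half-integer powers of
      the weight.\<close>
    define F where "F \<alpha> = cmod (f \<alpha>) / sqrt (a \<alpha>) ^ p" for \<alpha>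
    define G where "G \<beta> = cmod (g \<beta>) / sqrt (a \<beta>) ^ p" for \<beta>
    have F_sum: "sum F X \<le> Kf * sqrt S" if X: "finite X" "X \<subseteq> ell A" for X
    proof -
      \<comment> \<open>Splitting \<open>p\<close> as \<open>q + (p - q)\<close> lets
        Cauchy--Schwarz separate the \<open>q\<close>-norm of \<open>f\<close> from a pure sum of
        inverse weights.\<close>
      have "sum F X = (\<Sum>\<alpha>\<in>X. (cmod (f \<alpha>) / sqrt (a \<alpha>) ^ q) * (1 / sqrt (a \<alpha>) ^ (p - q)))"
        using pq by (simp add: F_def power_add[symmetric])
      then have "(sum F X)\<^sup>2 \<le> (\<Sum>\<alpha>\<in>X. (cmod (f \<alpha>) / sqrt (a \<alpha>) ^ q)\<^sup>2)
          * (\<Sum>\<alpha>\<in>X. (1 / sqrt (a \<alpha>) ^ (p - q))\<^sup>2)"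
        by (simp only: Cauchy_Schwarz_ineq_sum)
      also have "\<dots> \<le> Kf\<^sup>2 * S"
      proof (rule mult_mono)
        have "(\<Sum>\<alpha>\<in>X. (cmod (f \<alpha>) / sqrt (a \<alpha>) ^ q)\<^sup>2) = (\<Sum>\<alpha>\<in>X. (cmod (f \<alpha>))\<^sup>2 / a \<alpha> ^ q)"
          using X by (intro sum.cong refl) (auto simp: power_divide sqrt_sq)
        then show "(\<Sum>\<alpha>\<in>X. (cmod (f \<alpha>) / sqrt (a \<alpha>) ^ q)\<^sup>2) \<le> Kf\<^sup>2"
          using Kf(3)[OF X] by simp
        have "(\<Sum>\<alpha>\<in>X. (1 / sqrt (a \<alpha>) ^ (p - q))\<^sup>2) \<le> (\<Sum>\<alpha>\<in>X. 1 / a \<alpha> ^ d)"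
        proof (rule sum_mono)
          fix \<alpha> assume "\<alpha> \<in> X"
          then have \<alpha>: "\<alpha> \<in> ell A" using X by auto
          have "(1 / sqrt (a \<alpha>) ^ (p - q))\<^sup>2 = 1 / a \<alpha> ^ (p - q)"
            using \<alpha> by (simp add: power_divide sqrt_sq)
          also have "\<dots> \<le> 1 / a \<alpha> ^ d"
            using pq pos[OF \<alpha>] superexponential_ge_one[OF adm sup \<alpha>]
            by (intro divide_left_mono power_increasing mult_pos_pos zero_less_power) auto
          finally show "(1 / sqrt (a \<alpha>) ^ (p - q))\<^sup>2 \<le> 1 / a \<alpha> ^ d" .
        qed
        also have "\<dots> \<le> S"
          unfolding S_def by (rule sum_inverse_weight_le[OF reg sup X])
        finally show "(\<Sum>\<alpha>\<in>X. (1 / sqrt (a \<alpha>) ^ (p - q))\<^sup>2) \<le> S" .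
      qed (auto intro: sum_nonneg)
      also have "\<dots> = (Kf * sqrt S)\<^sup>2"
        using S by (simp add: power_mult_distrib)
      finally show ?thesis
        using Kf(1) S by (rule_tac power2_le_imp_le) auto
    qed
    have G_sum: "(\<Sum>\<beta>\<in>X. (G \<beta>)\<^sup>2) \<le> Kg\<^sup>2" if X: "finite X" "X \<subseteq> ell A" for X
    proof -
      have "(\<Sum>\<beta>\<in>X. (G \<beta>)\<^sup>2) = (\<Sum>\<beta>\<in>X. (cmod (g \<beta>))\<^sup>2 / a \<beta> ^ p)"
        using X by (intro sum.cong refl) (auto simp: G_def power_divide sqrt_sq)
      then show ?thesis using Kg(3)[OF X] by simp
    qed
    have "wnorm A a p (convolution A f g) \<le> ennreal (Kf * sqrt S * Kg)"
    proof (rule wnorm_le[OF adm])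
      show "0 \<le> Kf * sqrt S * Kg"
        using Kf(1) Kg(1) S by simp
      fix \<Gamma> assume \<Gamma>: "finite \<Gamma>" "\<Gamma> \<subseteq> ell A"
      let ?P = "\<lambda>\<gamma>. {(\<alpha>, \<beta>). \<alpha> \<in> ell A \<and> \<beta> \<in> ell A \<and> \<alpha> + \<beta> = \<gamma>}"
      have "(\<Sum>\<gamma>\<in>\<Gamma>. (cmod (convolution A f g \<gamma>))\<^sup>2 / a \<gamma> ^ p)
          \<le> (\<Sum>\<gamma>\<in>\<Gamma>. (\<Sum>(\<alpha>, \<beta>)\<in>?P \<gamma>. F \<alpha> * G \<beta>)\<^sup>2)"
      proof (rule sum_mono)
        fix \<gamma> assume "\<gamma> \<in> \<Gamma>"
        then have \<gamma>: "\<gamma> \<in> ell A" using \<Gamma> by auto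
        have "cmod (convolution A f g \<gamma>) / sqrt (a \<gamma>) ^ p
            \<le> (\<Sum>(\<alpha>, \<beta>)\<in>?P \<gamma>. cmod (f \<alpha>) * cmod (g \<beta>)) / sqrt (a \<gamma>) ^ p"
          unfolding convolution_def using pos[OF \<gamma>]
          by (intro divide_right_mono order.trans[OF norm_sum] sum_mono) (auto simp: norm_mult)
        also have "\<dots> = (\<Sum>(\<alpha>, \<beta>)\<in>?P \<gamma>. cmod (f \<alpha>) * cmod (g \<beta>) / sqrt (a \<gamma>) ^ p)"
          by (simp add: sum_divide_distrib case_prod_beta)
        also have "\<dots> \<le> (\<Sum>(\<alpha>, \<beta>)\<in>?P \<gamma>. F \<alpha> * G \<beta>)"
        proof (rule sum_mono, clarify)
          fix \<alpha> \<beta> assume \<alpha>\<beta>: "\<alpha> \<in> ell A" "\<beta> \<in> ell A" "\<gamma> = \<alpha> + \<beta>"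
          \<comment> \<open>Superexponentiality distributes the weight at \<gamma> over the two
            factors of the convolution.\<close>
          have "a \<alpha> * a \<beta> \<le> a (\<alpha> + \<beta>)"
            using sup \<alpha>\<beta> by (simp add: superexponential_def)
          then have "(sqrt (a \<alpha>) * sqrt (a \<beta>)) ^ p \<le> sqrt (a (\<alpha> + \<beta>)) ^ p"
            using pos \<alpha>\<beta> by (intro power_mono) (auto simp: real_sqrt_mult[symmetric] less_imp_le)
          then have "cmod (f \<alpha>) * cmod (g \<beta>) / sqrt (a (\<alpha> + \<beta>)) ^ p
              \<le> cmod (f \<alpha>) * cmod (g \<beta>) / (sqrt (a \<alpha>) * sqrt (a \<beta>)) ^ p"
            using pos \<alpha>\<beta> \<gamma> by (intro divide_left_mono mult_pos_pos zero_less_power) auto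
          then show "cmod (f \<alpha>) * cmod (g \<beta>) / sqrt (a (\<alpha> + \<beta>)) ^ p \<le> F \<alpha> * G \<beta>"
            by (simp add: F_def G_def power_mult_distrib)
        qed
        finally have "(cmod (convolution A f g \<gamma>) / sqrt (a \<gamma>) ^ p)\<^sup>2
            \<le> (\<Sum>(\<alpha>, \<beta>)\<in>?P \<gamma>. F \<alpha> * G \<beta>)\<^sup>2"
          using pos[OF \<gamma>] by (intro power_mono) auto
        then show "(cmod (convolution A f g \<gamma>))\<^sup>2 / a \<gamma> ^ p \<le> (\<Sum>(\<alpha>, \<beta>)\<in>?P \<gamma>. F \<alpha> * G \<beta>)\<^sup>2"
          using \<gamma> by (simp add: power_divide sqrt_sq)
      qed
      also have "\<dots> \<le> (Kf * sqrt S)\<^sup>2 * Kg\<^sup>2"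
        using \<Gamma>(1) finite_convolution_index F_sum G_sum
        by (intro sum_convolution_square_le) (auto simp: F_def pos less_imp_le)
      finally show "(\<Sum>\<gamma>\<in>\<Gamma>. (cmod (convolution A f g \<gamma>))\<^sup>2 / a \<gamma> ^ p) \<le> (Kf * sqrt S * Kg)\<^sup>2"
        by (simp add: power_mult_distrib)
    qed
    also have "\<dots> = ennreal (sqrt S) * wnorm A a q f * wnorm A a p g"
      using S Kf(1,2) Kg(1,2) by (simp add: ennreal_mult mult_ac)
    finally show ?thesis .
  qed
  then show ?thesis
    using d S unfolding vage_gap_def by (intro conjI exI[of _ "\<lambda>_. sqrt S"]) auto
qed

section \<open>Point masses and the converse\<close>

lemma wnorm_point_mass:
  assumes "\<alpha> \<in> ell A"
  shows "wnorm A a p (\<lambda>x. of_bool (x = \<alpha>)) = ennreal (sqrt (1 / a \<alpha> ^ p))"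
proof -
  have "((\<lambda>x. (cmod (of_bool (x = \<alpha>)))\<^sup>2 / a x ^ p) has_sum 1 / a \<alpha> ^ p) (ell A)"
    by (rule has_sum_finite_neutralI[of "{\<alpha>}"]) (use assms in auto)
  then show ?thesis
    unfolding wnorm_def by (auto simp: infsumI summable_on_def)
qed

lemma point_mass_weighted_l2:
  "\<alpha> \<in> ell A \<Longrightarrow> (\<lambda>x. of_bool (x = \<alpha>)) \<in> weighted_l2 A a p"
  by (auto simp: weighted_l2_def families_def wnorm_point_mass)

lemma convolution_point_mass:
  assumes "\<alpha> \<in> ell A" "\<beta> \<in> ell A"
  shows "convolution A (\<lambda>x. of_bool (x = \<alpha>)) (\<lambda>x. of_bool (x = \<beta>)) = (\<lambda>x. of_bool (x = \<alpha> + \<beta>))"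
proof
  fix \<gamma>
  let ?P = "{(x, y). x \<in> ell A \<and> y \<in> ell A \<and> x + y = \<gamma>}"
  have "convolution A (\<lambda>x. of_bool (x = \<alpha>)) (\<lambda>x. of_bool (x = \<beta>)) \<gamma>
      = (\<Sum>z\<in>?P. if z = (\<alpha>, \<beta>) then 1 else 0)"
    unfolding convolution_def by (intro sum.cong) auto
  also have "\<dots> = of_bool (\<gamma> = \<alpha> + \<beta>)"
    using assms by (subst sum.delta[OF finite_convolution_index]) auto
  finally show "convolution A (\<lambda>x. of_bool (x = \<alpha>)) (\<lambda>x. of_bool (x = \<beta>)) \<gamma>
      = of_bool (\<gamma> = \<alpha> + \<beta>)" .
qed

text \<open>Any gap \<open>e\<close> will do, however large. With \<open>p = q + e\<close> the
  constant is \<open>C e\<close> for every \<open>q\<close>, while a ratio above 1 would have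
  unbounded powers.\<close>

lemma vage_gap_imp_superexponential:
  assumes adm: "admissible A a" and gap: "vage_gap A a e"
  shows "superexponential A a"
  unfolding superexponential_def
proof (intro ballI, rule ccontr)
  fix \<alpha> \<beta> assume \<alpha>: "\<alpha> \<in> ell A" and \<beta>: "\<beta> \<in> ell A"
    and less: "\<not> a \<alpha> * a \<beta> \<le> a (\<alpha> + \<beta>)"
  have \<gamma>: "\<alpha> + \<beta> \<in> ell A"
    using \<alpha> \<beta> by (rule ell_add)
  have pos: "0 < a \<alpha>" "0 < a \<beta>" "0 < a (\<alpha> + \<beta>)"
    using admissible_pos[OF adm] \<alpha> \<beta> \<gamma> by auto
  obtain C where C: "0 < C e"
    and vage: "\<And>q p f g. 1 \<le> q \<Longrightarrow> q + e \<le> p \<Longrightarrow> f \<in> weighted_l2 A a q \<Longrightarrow> g \<in> weighted_l2 A a p \<Longrightarrow>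
      wnorm A a p (convolution A f g) \<le> ennreal (C (p - q)) * wnorm A a q f * wnorm A a p g"
    using gap unfolding vage_gap_def by auto
  define r where "r = a \<alpha> * a \<beta> / a (\<alpha> + \<beta>)"
  have r: "1 < r"
    using less pos by (simp add: r_def)
  \<comment> \<open>The quotient on the right comes from the \<open>e\<close> extra powers in
    \<open>p = q + e\<close>. What matters is that the right-hand side is free of
    \<open>q\<close>.\<close>
  have bound: "r ^ q \<le> (C e)\<^sup>2 * (a (\<alpha> + \<beta>) ^ e / a \<beta> ^ e)" if "1 \<le> q" for q
  proof -
    have "ennreal (sqrt (1 / a (\<alpha> + \<beta>) ^ (q + e)))
        \<le> ennreal (C e) * ennreal (sqrt (1 / a \<alpha> ^ q)) * ennreal (sqrt (1 / a \<beta> ^ (q + e)))"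
      using vage[OF that le_refl point_mass_weighted_l2[OF \<alpha>] point_mass_weighted_l2[OF \<beta>]]
      by (simp add: convolution_point_mass \<alpha> \<beta> \<gamma> wnorm_point_mass)
    also have "\<dots> = ennreal (C e * sqrt (1 / a \<alpha> ^ q) * sqrt (1 / a \<beta> ^ (q + e)))"
      using C pos by (simp add: ennreal_mult)
    finally have "sqrt (1 / a (\<alpha> + \<beta>) ^ (q + e))
        \<le> C e * sqrt (1 / a \<alpha> ^ q) * sqrt (1 / a \<beta> ^ (q + e))"
      using C pos by (subst (asm) ennreal_le_iff) auto
    then have "(sqrt (1 / a (\<alpha> + \<beta>) ^ (q + e)))\<^sup>2
        \<le> (C e * sqrt (1 / a \<alpha> ^ q) * sqrt (1 / a \<beta> ^ (q + e)))\<^sup>2"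
      using pos by (intro power_mono) auto
    then have "1 / a (\<alpha> + \<beta>) ^ (q + e) \<le> (C e)\<^sup>2 * (1 / a \<alpha> ^ q) * (1 / a \<beta> ^ (q + e))"
      using pos by (simp only: power_mult_distrib) simp
    then show ?thesis
      using pos by (simp add: r_def power_divide power_mult_distrib power_add field_simps)
  qed
  obtain n where n: "(C e)\<^sup>2 * (a (\<alpha> + \<beta>) ^ e / a \<beta> ^ e) < r ^ n"
    using real_arch_pow[OF r] by blast
  \<comment> \<open>The exponent \<open>n\<close> may be 0, whereas \<open>bound\<close> requires at
    least 1.\<close>
  also have "r ^ n \<le> r ^ Suc n"
    using r by (intro power_increasing) auto
  also have "\<dots> \<le> (C e)\<^sup>2 * (a (\<alpha> + \<beta>) ^ e / a \<beta> ^ e)"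
    by (rule bound) simp
  finally show False by simp
qed

theorem theorem3p3:
  fixes A :: "nat set" and d :: nat and a :: "(nat \<Rightarrow>\<^sub>0 nat) \<Rightarrow> real"
  assumes "A \<subseteq> {1..}"
    and "d \<ge> 1"
    and "regular_admissible A d a"
  shows "(vage_space A a \<longleftrightarrow> superexponential A a) \<and>
         (vage_space A a \<longrightarrow> vage_index A a \<le> d)"
proof -
  have sup: "superexponential A a" if "vage_space A a"
    using that assms(3) vage_gap_imp_superexponential
    by (auto simp: vage_space_def regular_admissible_def)
  \<comment> \<open>\<open>d\<close> itself is a gap. It witnesses the Vage property and, by
    \<open>Least_le\<close>, bounds the index.\<close>
  have gap: "vage_gap A a d" if "superexponential A a"
    using superexponential_imp_vage_gap[OF assms(3) that] .
  show ?thesis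
    using sup gap assms(3) unfolding vage_space_def vage_index_def by (blast intro: Least_le)
qed

end
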